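(* Let $\mathrm{a}_{n,k}^{\mathrm{vl}}(132,321)$ denote the number of permutations of $\{1,\dots,n\}$ that avoid both $132$ and $321$ and have exactly $k$ valleys. Then $$\mathrm{a}_{n,k}^{\mathrm{vl}}(132,321)=\begin{cases}2,&k=0;\\ \binom{n}{2}-1,&k=1;\\ 0,&\text{otherwise}.\end{cases}$$
   Context: $\mathcal{S}_n$ is the set of permutations $\pi=\pi_1\cdots\pi_n$ of $\{1,\dots,n\}$. For $\rho\in\mathcal{S}_m$, $\pi\in\mathcal{S}_n$ contains $\rho$ if there are indices $1\le i_1<\cdots<i_m\le n$ such that $\pi_{i_a}<\pi_{i_b}$ if and only if $\rho_a<\rho_b$; otherwise $\pi$ avoids $\rho$. The number of valleys is $\mathrm{vl}(\pi)=|\{i:\pi_i>\pi_{i+1}\text{ and }\pi_{i+1}<\pi_{i+2}\}|$, where $1\le i\le n-2$.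
   Formalization: The formal theorem assumes n ≥ 2, since for n = 0 and n = 1 there is only one permutation, with no valleys, so the count for k = 0 is 1 rather than 2, and the value binom(n,2) − 1 for k = 1 would be −1. *)

theory Defs
  imports "HOL-Combinatorics.Multiset_Permutations"
begin

text \<open>A permutation of {1..n} is given in one-line notation, as an element of
  \<open>permutations_of_set {1..n}\<close>. The entries are 1, ..., n, while list positions
  count from 0, so the entry written pi_i on paper is \<open>\<pi> ! (i - 1)\<close>.\<close>

definition contains_pattern :: "nat list \<Rightarrow> nat list \<Rightarrow> bool" where
  "contains_pattern \<pi> \<rho> \<longleftrightarrow>
     (\<exists>f :: nat \<Rightarrow> nat. strict_mono_on {..<length \<rho>} f \<and>
        f ` {..<length \<rho>} \<subseteq> {..<length \<pi>} \<and>
        (\<forall>a<length \<rho>. \<forall>b<length \<rho>. \<pi> ! f a < \<pi> ! f b \<longleftrightarrow> \<rho> ! a < \<rho> ! b))"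

abbreviation avoids_pattern :: "nat list \<Rightarrow> nat list \<Rightarrow> bool" where
  "avoids_pattern \<pi> \<rho> \<equiv> \<not> contains_pattern \<pi> \<rho>"

definition valleys :: "nat list \<Rightarrow> nat" where
  "valleys \<pi> = card {i. i + 2 < length \<pi> \<and> \<pi> ! i > \<pi> ! (i + 1) \<and> \<pi> ! (i + 1) < \<pi> ! (i + 2)}"

definition avoiders_with_valleys :: "nat \<Rightarrow> nat \<Rightarrow> nat list set \<Rightarrow> nat list set" where
  "avoiders_with_valleys n k P =
     {\<pi> \<in> permutations_of_set {1..n}. (\<forall>\<rho>\<in>P. avoids_pattern \<pi> \<rho>) \<and> valleys \<pi> = k}"

definition a_vl :: "nat \<Rightarrow> nat \<Rightarrow> nat list set \<Rightarrow> nat" where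
  "a_vl n k P = card (avoiders_with_valleys n k P)"

end

theory Submission
  imports Defs
begin

text \<open>The entries before the maximum of a \<open>132\<close>-avoiding permutation exceed the entries
  after it, and in a \<open>321\<close>-avoiding one the latter increase; if there are any, the former
  increase as well. Removing final maxima one by one therefore shows that every avoider other than
  the identity is obtained by swapping two nonempty adjacent blocks \<open>1, \<dots>, b\<close> and
  \<open>b + 1, \<dots>, m\<close> at the start of the identity. Such a permutation has a single descent, from
  \<open>m\<close> to \<open>1\<close>, and this is a valley unless \<open>1\<close> is the last entry, i.e. \<open>b = 1\<close> and \<open>m = n\<close>.\<close>

section \<open>Occurrences of patterns of length three\<close>

lemma contains_pattern_3:
  "contains_pattern \<pi> [x, y, z] \<longleftrightarrow>
     (\<exists>i j k. i < j \<and> j < k \<and> k < length \<pi> \<and>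
        (\<pi> ! i < \<pi> ! j \<longleftrightarrow> x < y) \<and> (\<pi> ! j < \<pi> ! i \<longleftrightarrow> y < x) \<and>
        (\<pi> ! i < \<pi> ! k \<longleftrightarrow> x < z) \<and> (\<pi> ! k < \<pi> ! i \<longleftrightarrow> z < x) \<and>
        (\<pi> ! j < \<pi> ! k \<longleftrightarrow> y < z) \<and> (\<pi> ! k < \<pi> ! j \<longleftrightarrow> z < y))"
  (is "?L \<longleftrightarrow> ?R")
proof
  have idx: "{..<length [x, y, z]} = {0, 1, 2}"
    by auto
  assume ?L
  then obtain f :: "nat \<Rightarrow> nat" where mono: "strict_mono_on {0, 1, 2} f"
    and ran: "f ` {0, 1, 2} \<subseteq> {..<length \<pi>}"
    and cmp: "\<And>a b. a < 3 \<Longrightarrow> b < 3 \<Longrightarrow> \<pi> ! f a < \<pi> ! f b \<longleftrightarrow> [x, y, z] ! a < [x, y, z] ! b"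
    unfolding contains_pattern_def idx by (auto simp: numeral_3_eq_3)
  have "f 0 < f 1" "f 1 < f 2" "f 2 < length \<pi>"
    using mono ran by (auto simp: strict_mono_on_def)
  \<comment> \<open>Only the six ordered pairs of distinct positions matter: comparing an entry with
    itself is false on both sides.\<close>
  then show ?R
    using cmp[of 0 1] cmp[of 1 0] cmp[of 0 2] cmp[of 2 0] cmp[of 1 2] cmp[of 2 1]
    by (intro exI[of _ "f 0"] exI[of _ "f 1"] exI[of _ "f 2"]) simp
next
  assume ?R
  then obtain i j k where ijk: "i < j" "j < k" "k < length \<pi>"
    and cmp: "\<pi> ! i < \<pi> ! j \<longleftrightarrow> x < y" "\<pi> ! j < \<pi> ! i \<longleftrightarrow> y < x"
      "\<pi> ! i < \<pi> ! k \<longleftrightarrow> x < z" "\<pi> ! k < \<pi> ! i \<longleftrightarrow> z < x"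
      "\<pi> ! j < \<pi> ! k \<longleftrightarrow> y < z" "\<pi> ! k < \<pi> ! j \<longleftrightarrow> z < y"
    by blast
  \<comment> \<open>The list of chosen positions, read as a function of its index, serves as the
    embedding.\<close>
  show ?L
    unfolding contains_pattern_def
    using ijk cmp
    by (intro exI[of _ "\<lambda>a. [i, j, k] ! a"])
      (auto simp: strict_mono_on_def less_Suc_eq numeral_3_eq_3)
qed

text \<open>The two inequalities form a chain through all three entries, which settles all six
  comparisons.\<close>

lemma contains_132_iff:
  "contains_pattern \<pi> [1, 3, 2] \<longleftrightarrow>
     (\<exists>i j k. i < j \<and> j < k \<and> k < length \<pi> \<and> \<pi> ! i < \<pi> ! k \<and> \<pi> ! k < \<pi> ! j)"
  unfolding contains_pattern_3 by (rule iff_exI)+ auto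

lemma contains_321_iff:
  "contains_pattern \<pi> [3, 2, 1] \<longleftrightarrow>
     (\<exists>i j k. i < j \<and> j < k \<and> k < length \<pi> \<and> \<pi> ! k < \<pi> ! j \<and> \<pi> ! j < \<pi> ! i)"
  unfolding contains_pattern_3 by (rule iff_exI)+ auto

section \<open>Block swaps of the identity\<close>

definition swap_blocks :: "nat \<Rightarrow> nat \<Rightarrow> nat \<Rightarrow> nat list" where
  "swap_blocks n m b = [Suc b..<Suc m] @ [1..<Suc b] @ [Suc m..<Suc n]"

definition avoiders :: "nat \<Rightarrow> nat list set" where
  "avoiders n = {\<pi> \<in> permutations_of_set {1..n}.
     avoids_pattern \<pi> [1, 3, 2] \<and> avoids_pattern \<pi> [3, 2, 1]}"

text \<open>The bounds keep both blocks nonempty. The degenerate cases \<open>b = 0\<close> and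
  \<open>b = m\<close> all give the identity and would spoil injectivity.\<close>

definition swap_params :: "nat \<Rightarrow> (nat \<times> nat) set" where
  "swap_params n = (SIGMA m:{..n}. {1..<m})"

lemma length_swap_blocks: "b \<le> m \<Longrightarrow> m \<le> n \<Longrightarrow> length (swap_blocks n m b) = n"
  by (simp add: swap_blocks_def del: upt_Suc)

lemma nth_swap_blocks:
  assumes "b \<le> m" "m \<le> n" "p < n"
  shows "swap_blocks n m b ! p =
    (if p + b < m then p + b + 1 else if p < m then p + b + 1 - m else p + 1)"
  using assms by (auto simp: swap_blocks_def nth_append simp del: upt_Suc)

text \<open>Every inversion pairs an entry of the first block with one of the second. In a 132 the
  last two entries would be such a pair, so the first entry would also lie in the first block and
  exceed the last. In a 321 the middle entry would lie in both blocks.\<close>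

lemma swap_blocks_in_avoiders:
  assumes "b \<le> m" "m \<le> n"
  shows "swap_blocks n m b \<in> avoiders n"
  unfolding avoiders_def
proof (intro CollectI conjI)
  show "swap_blocks n m b \<in> permutations_of_set {1..n}"
    using assms by (auto simp: permutations_of_set_def swap_blocks_def simp del: upt_Suc)
  show "avoids_pattern (swap_blocks n m b) [1, 3, 2]"
    unfolding contains_132_iff using assms
    by (auto simp: length_swap_blocks nth_swap_blocks split: if_splits)
  show "avoids_pattern (swap_blocks n m b) [3, 2, 1]"
    unfolding contains_321_iff using assms
    by (auto simp: length_swap_blocks nth_swap_blocks split: if_splits)
qed

lemma swap_blocks_0: "m \<le> n \<Longrightarrow> swap_blocks n m 0 = [1..<Suc n]"
  by (intro nth_equalityI) (auto simp: length_swap_blocks nth_swap_blocks simp del: upt_Suc)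

lemma swap_blocks_snoc: "m \<le> n \<Longrightarrow> swap_blocks n m b @ [Suc n] = swap_blocks (Suc n) m b"
  by (simp add: swap_blocks_def)

section \<open>Structure of avoiders by the position of the maximum\<close>

lemma avoiders_snoc:
  assumes "A @ [Suc n] \<in> avoiders (Suc n)"
  shows "A \<in> avoiders n"
proof -
  have dist: "distinct A" "Suc n \<notin> set A" and set: "insert (Suc n) (set A) = {1..Suc n}"
    using assms by (auto simp: avoiders_def permutations_of_set_def)
  have "set A = insert (Suc n) (set A) - {Suc n}"
    using dist by auto
  also have "\<dots> = {1..n}"
    unfolding set by auto
  finally have perm: "A \<in> permutations_of_set {1..n}"
    using dist by (simp add: permutations_of_set_def)
  have lift: "i < length A \<Longrightarrow> (A @ [Suc n]) ! i = A ! i" for i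
    by (simp add: nth_append)
  have "avoids_pattern A [1, 3, 2]"
  proof
    assume "contains_pattern A [1, 3, 2]"
    then obtain i j k where "i < j" "j < k" "k < length A" "A ! i < A ! k" "A ! k < A ! j"
      unfolding contains_132_iff by blast
    then have "contains_pattern (A @ [Suc n]) [1, 3, 2]"
      unfolding contains_132_iff by (intro exI[of _ i] exI[of _ j] exI[of _ k]) (simp add: lift)
    then show False using assms by (simp add: avoiders_def)
  qed
  moreover have "avoids_pattern A [3, 2, 1]"
  proof
    assume "contains_pattern A [3, 2, 1]"
    then obtain i j k where "i < j" "j < k" "k < length A" "A ! k < A ! j" "A ! j < A ! i"
      unfolding contains_321_iff by blast
    then have "contains_pattern (A @ [Suc n]) [3, 2, 1]"
      unfolding contains_321_iff by (intro exI[of _ i] exI[of _ j] exI[of _ k]) (simp add: lift)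
    then show False using assms by (simp add: avoiders_def)
  qed
  ultimately show ?thesis
    using perm by (simp add: avoiders_def)
qed

text \<open>Both \<open>A\<close> and \<open>B\<close> increase and \<open>B\<close> lies below
  \<open>A\<close>, so \<open>B @ A @ [Suc n]\<close> is the increasing list of all values; cutting
  it after \<open>length B\<close> entries recovers the two blocks.\<close>

lemma avoiders_max_not_last:
  assumes \<pi>: "A @ Suc n # B \<in> avoiders (Suc n)" and "B \<noteq> []"
  shows "A @ Suc n # B = swap_blocks (Suc n) (Suc n) (length B)"
proof -
  define P where "P = A @ Suc n # B"
  have dist: "distinct P" and set: "set P = {1..Suc n}"
    and a132: "\<And>i j k. i < j \<Longrightarrow> j < k \<Longrightarrow> k < length P \<Longrightarrow> P ! i < P ! k \<Longrightarrow> \<not> P ! k < P ! j"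
    and a321: "\<And>i j k. i < j \<Longrightarrow> j < k \<Longrightarrow> k < length P \<Longrightarrow> P ! k < P ! j \<Longrightarrow> \<not> P ! j < P ! i"
    using \<pi> unfolding P_def[symmetric] avoiders_def permutations_of_set_def
      contains_132_iff contains_321_iff by blast+
  define a where "a = length A"
  have len: "length P = a + 1 + length B" and Pa: "P ! a = Suc n"
    and PA: "\<And>i. i < a \<Longrightarrow> P ! i = A ! i" and PB: "\<And>i. P ! Suc (a + i) = B ! i"
    by (simp_all add: P_def a_def nth_append)
  have less_max: "P ! i < Suc n" if "i < length P" "i \<noteq> a" for i
  proof -
    have "P ! i \<in> {1..Suc n}" using that set nth_mem by metis
    moreover have "P ! i \<noteq> P ! a" using that dist len by (simp add: nth_eq_iff_index_eq)
    ultimately show ?thesis using Pa by auto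
  qed
  have neq: "P ! i \<noteq> P ! j" if "i < j" "j < length P" for i j
    using that dist by (simp add: nth_eq_iff_index_eq)
  \<comment> \<open>The maximum would act as the 3 of a 132.\<close>
  have B_less_A: "P ! k < P ! i" if "i < a" "a < k" "k < length P" for i k
    using a132[of i a k] less_max[of k] neq[of i k] that Pa by linarith
  \<comment> \<open>The maximum would act as the 3 of a 321.\<close>
  have B_mono: "P ! j < P ! k" if "a < j" "j < k" "k < length P" for j k
    using a321[of a j k] less_max[of j] neq[of j k] that Pa by linarith
  \<comment> \<open>Position \<open>a + 1\<close> holds the first entry of \<open>B\<close>, which
    lies below all of \<open>A\<close> and would complete a descending pair in \<open>A\<close> to a
    321.\<close>
  have A_mono: "P ! i < P ! j" if "i < j" "j < a" for i j
    using a321[of i j "a + 1"] B_less_A[of j "a + 1"] neq[of i j] that len \<open>B \<noteq> []\<close>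
    by (cases B) auto
  have "sorted_wrt (<) B"
    unfolding sorted_wrt_iff_nth_less
  proof (intro allI impI)
    fix i j assume "i < j" "j < length B"
    then show "B ! i < B ! j" using B_mono[of "a + 1 + i" "a + 1 + j"] by (simp add: PB len)
  qed
  moreover have "sorted_wrt (<) A"
    unfolding sorted_wrt_iff_nth_less using A_mono PA by (simp add: a_def)
  moreover have "\<forall>x\<in>set A. x < Suc n"
  proof
    fix x assume "x \<in> set A"
    then obtain i where "i < a" "x = A ! i"
      by (auto simp: in_set_conv_nth a_def)
    then show "x < Suc n" using less_max[of i] by (simp add: PA len)
  qed
  moreover have "\<forall>x\<in>set B. \<forall>y\<in>set A. x < y"
  proof (intro ballI)
    fix x y assume "x \<in> set B" "y \<in> set A"
    then obtain k i where "k < length B" "x = B ! k" "i < a" "y = A ! i"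
      by (auto simp: in_set_conv_nth a_def)
    then show "x < y" using B_less_A[of i "a + 1 + k"] by (simp add: PA PB len)
  qed
  moreover have "\<forall>x\<in>set B. x < Suc n"
  proof
    fix x assume "x \<in> set B"
    then obtain k where "k < length B" "x = B ! k"
      by (auto simp: in_set_conv_nth)
    then show "x < Suc n" using less_max[of "a + 1 + k"] by (simp add: PB len)
  qed
  ultimately have "sorted_wrt (<) (B @ A @ [Suc n])"
    by (auto simp: sorted_wrt_append)
  moreover have "set (B @ A @ [Suc n]) = set [1..<Suc (Suc n)]"
  proof -
    have "set (B @ A @ [Suc n]) = set P"
      unfolding P_def by auto
    then show ?thesis
      unfolding set by (simp add: atLeastLessThanSuc_atLeastAtMost del: upt_Suc)
  qed
  \<comment> \<open>A strictly increasing list is determined by its set of entries.\<close>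
  ultimately have eq: "B @ A @ [Suc n] = [1..<Suc (Suc n)]"
    by (intro strict_sorted_equal) (simp_all del: upt_Suc)
  have B: "B = take (length B) [1..<Suc (Suc n)]"
    and A: "A @ [Suc n] = drop (length B) [1..<Suc (Suc n)]"
    unfolding eq[symmetric] by simp_all
  have "length B \<le> Suc n"
    using arg_cong[OF eq, of length] by (simp del: upt_Suc)
  then have "B = [1..<Suc (length B)]" "A @ [Suc n] = [Suc (length B)..<Suc (Suc n)]"
    using B A by (simp_all add: take_upt drop_upt del: upt_Suc)
  moreover have "A @ Suc n # B = (A @ [Suc n]) @ B"
    by simp
  ultimately show ?thesis
    by (simp add: swap_blocks_def del: upt_Suc append_assoc)
qed

text \<open>A final maximum is stripped, and putting it back leaves the parameters \<open>m\<close>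
  and \<open>b\<close> unchanged. A maximum elsewhere forces \<open>m = Suc n\<close>, with
  \<open>b\<close> the number of entries after it.\<close>

lemma avoiders_subset:
  "avoiders n \<subseteq> insert [1..<Suc n] ((\<lambda>(m, b). swap_blocks n m b) ` swap_params n)"
proof (induction n)
  case 0
  then show ?case by (auto simp: avoiders_def permutations_of_set_def)
next
  case (Suc n)
  show ?case
  proof
    fix \<pi> assume \<pi>: "\<pi> \<in> avoiders (Suc n)"
    then have "Suc n \<in> set \<pi>" and dist: "distinct \<pi>" and len: "length \<pi> = Suc n"
      by (auto simp: avoiders_def permutations_of_set_def dest: distinct_card)
    then obtain A B where AB: "\<pi> = A @ Suc n # B"
      by (meson split_list)
    show "\<pi> \<in> insert [1..<Suc (Suc n)] ((\<lambda>(m, b). swap_blocks (Suc n) m b) ` swap_params (Suc n))"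
    proof (cases "B = []")
      case True
      then have "A \<in> avoiders n"
        using \<pi> AB avoiders_snoc by simp
      with Suc.IH consider "A = [1..<Suc n]"
        | m b where "A = swap_blocks n m b" "(m, b) \<in> swap_params n"
        by auto
      then show ?thesis
      proof cases
        case 1
        then show ?thesis using AB True by simp
      next
        case 2
        then have "\<pi> = swap_blocks (Suc n) m b" "(m, b) \<in> swap_params (Suc n)"
          using AB True swap_blocks_snoc by (auto simp: swap_params_def)
        then show ?thesis by force
      qed
    next
      case False
      then have "\<pi> = swap_blocks (Suc n) (Suc n) (length B)"
        using \<pi> AB avoiders_max_not_last by simp
      moreover have "(Suc n, length B) \<in> swap_params (Suc n)"
        using False len AB by (cases B) (auto simp: swap_params_def)
      ultimately show ?thesis
        by (intro insertI2 image_eqI[of _ _ "(Suc n, length B)"]) simp_all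
    qed
  qed
qed

lemma avoiders_eq:
  "avoiders n = insert [1..<Suc n] ((\<lambda>(m, b). swap_blocks n m b) ` swap_params n)"
proof -
  \<comment> \<open>The identity is the degenerate swap with \<open>m = b = 0\<close>.\<close>
  have "[1..<Suc n] \<in> avoiders n"
    using swap_blocks_in_avoiders[of 0 0 n] swap_blocks_0[of 0 n] by simp
  then show ?thesis
    using avoiders_subset[of n] swap_blocks_in_avoiders[of _ _ n]
    by (fastforce simp: swap_params_def)
qed

section \<open>Number of valleys of each avoider\<close>

lemma valleys_upt: "valleys [1..<Suc n] = 0"
proof -
  have "{i. i + 2 < length [1..<Suc n] \<and> [1..<Suc n] ! i > [1..<Suc n] ! (i + 1) \<and>
      [1..<Suc n] ! (i + 1) < [1..<Suc n] ! (i + 2)} = {}"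
    by (auto simp del: upt_Suc)
  then show ?thesis
    unfolding valleys_def by (simp only: card.empty)
qed

lemma valleys_swap_blocks:
  assumes "(m, b) \<in> swap_params n"
  shows "valleys (swap_blocks n m b) = (if m = n \<and> b = 1 then 0 else 1)"
proof -
  have b: "1 \<le> b" "b < m" "m \<le> n"
    using assms by (auto simp: swap_params_def)
  let ?w = "swap_blocks n m b"
  \<comment> \<open>Counting from 0, \<open>m - b - 1\<close> is the position of the entry
    \<open>m\<close>, and the entry 1 comes next. A third entry exists unless
    \<open>m - b + 1 = n\<close>, which under the bounds means \<open>m = n\<close> and
    \<open>b = 1\<close>.\<close>
  have "{i. i + 2 < length ?w \<and> ?w ! i > ?w ! (i + 1) \<and> ?w ! (i + 1) < ?w ! (i + 2)} =
      (if m = n \<and> b = 1 then {} else {m - b - 1})"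
    using b by (auto simp: length_swap_blocks nth_swap_blocks split: if_splits)
  then show ?thesis
    unfolding valleys_def by simp
qed

section \<open>Counting the block swaps\<close>

lemma inj_on_swap_blocks: "inj_on (\<lambda>(m, b). swap_blocks n m b) (swap_params n)"
proof (rule inj_onI, clarify)
  fix m b m' b'
  assume "(m, b) \<in> swap_params n" "(m', b') \<in> swap_params n"
    and eq: "swap_blocks n m b = swap_blocks n m' b'"
  then have b: "1 \<le> b" "b < m" "m \<le> n" "1 \<le> b'" "b' < m'" "m' \<le> n"
    by (auto simp: swap_params_def)
  \<comment> \<open>The first entry is \<open>b + 1\<close>.\<close>
  have "b = b'"
    using arg_cong[OF eq, of "\<lambda>w. w ! 0"] b by (simp add: nth_swap_blocks)
  \<comment> \<open>At position \<open>m - b\<close> the second block of one list starts with 1,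
    while the other list, still in its first block, has \<open>m + 1\<close>.\<close>
  moreover have "\<not> m < m'"
  proof
    assume "m < m'"
    then show False
      using arg_cong[OF eq, of "\<lambda>w. w ! (m - b)"] b \<open>b = b'\<close> by (simp add: nth_swap_blocks)
  qed
  moreover have "\<not> m' < m"
  proof
    assume "m' < m"
    then show False
      using arg_cong[OF eq, of "\<lambda>w. w ! (m' - b')"] b \<open>b = b'\<close> by (simp add: nth_swap_blocks)
  qed
  ultimately show "m = m' \<and> b = b'" by simp
qed

lemma finite_swap_params: "finite (swap_params n)"
  by (simp add: swap_params_def)

lemma card_swap_params: "card (swap_params n) = n choose 2"
proof -
  \<comment> \<open>Each \<open>m\<close> allows \<open>m - 1\<close> values of \<open>b\<close>;
    truncated subtraction gives the right count 0 at \<open>m = 0\<close>.\<close>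
  have "card (swap_params n) = (\<Sum>m\<le>n. m - 1)"
    by (simp add: swap_params_def)
  also have "\<dots> = n choose 2"
    \<comment> \<open>Writing 2 as a successor exposes Pascal's rule: passing from \<open>n\<close>
      to \<open>n + 1\<close> adds \<open>n\<close>.\<close>
    by (induction n) (simp_all add: numeral_2_eq_2)
  finally show ?thesis .
qed

lemma upt_notin_swap_blocks: "[1..<Suc n] \<notin> (\<lambda>(m, b). swap_blocks n m b) ` swap_params n"
proof
  assume "[1..<Suc n] \<in> (\<lambda>(m, b). swap_blocks n m b) ` swap_params n"
  then obtain m b where "(m, b) \<in> swap_params n" and eq: "[1..<Suc n] = swap_blocks n m b"
    by auto
  then have "1 \<le> b" "b < m" "m \<le> n"
    by (auto simp: swap_params_def)
  then show False
    \<comment> \<open>The first entry is 1 on one side and \<open>b + 1 \<ge> 2\<close> on the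
      other.\<close>
    using arg_cong[OF eq, of "\<lambda>w. w ! 0"] by (simp add: nth_swap_blocks del: upt_Suc)
qed

theorem proposition25:
  fixes n k :: nat
  assumes "n \<ge> 2"
  shows "int (a_vl n k {[1, 3, 2], [3, 2, 1]}) =
    (if k = 0 then 2 else if k = 1 then int (n choose 2) - 1 else 0)"
proof -
  let ?w = "\<lambda>(m, b). swap_blocks n m b"
  \<comment> \<open>This pair encodes 2, ..., n, 1, the only proper swap without a valley; it is
    admissible because \<open>n \<ge> 2\<close>.\<close>
  have last: "(n, 1) \<in> swap_params n"
    using assms by (simp add: swap_params_def)
  have "avoiders_with_valleys n k {[1, 3, 2], [3, 2, 1]} = {\<pi> \<in> avoiders n. valleys \<pi> = k}"
    by (auto simp: avoiders_with_valleys_def avoiders_def)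
  also have "\<dots> = (if k = 0 then {[1..<Suc n], ?w (n, 1)}
      else if k = 1 then ?w ` (swap_params n - {(n, 1)}) else {})"
  proof -
    have "valleys (?w x) = (if x = (n, 1) then 0 else 1)" if "x \<in> swap_params n" for x
      using that by (cases x) (simp add: valleys_swap_blocks)
    then have "{x \<in> swap_params n. valleys (?w x) = k} =
        (if k = 0 then {(n, 1)} else if k = 1 then swap_params n - {(n, 1)} else {})"
      using last by (auto split: if_splits)
    moreover have "{\<pi> \<in> avoiders n. valleys \<pi> = k} =
        {\<pi>. \<pi> = [1..<Suc n] \<and> k = 0} \<union> ?w ` {x \<in> swap_params n. valleys (?w x) = k}"
      unfolding avoiders_eq using valleys_upt[of n] by blast
    ultimately show ?thesis by (auto simp del: upt_Suc)
  qed
  finally have *: "avoiders_with_valleys n k {[1, 3, 2], [3, 2, 1]} = \<dots>" .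
  \<comment> \<open>The two avoiders without valleys are distinct, so the case \<open>k = 0\<close>
    counts 2.\<close>
  have "[1..<Suc n] \<noteq> ?w (n, 1)"
    using upt_notin_swap_blocks[of n] last by (metis imageI)
  moreover have "card (?w ` (swap_params n - {(n, 1)})) = (n choose 2) - 1"
    using last by (subst card_image)
      (auto intro: inj_on_subset[OF inj_on_swap_blocks] simp: finite_swap_params card_swap_params)
  \<comment> \<open>This makes the subtraction of 1 on the naturals exact, so that it passes through
    \<open>int\<close>.\<close>
  moreover have "1 \<le> n choose 2"
    using assms zero_less_binomial[of 2 n] by linarith
  ultimately show ?thesis
    unfolding a_vl_def * by (simp add: of_nat_diff del: upt_Suc)
qed

end
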